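(* Let $\mathcal D\subseteq\mathbb R^n$ be the nonempty domain of the objective function $f$, and consider the (possibly non-convex) primal problem $$p^*:=\min_{x\in\mathcal D} f(x)\quad\text{s.t.}\quad \Phi_i(x)\preceq 0,\quad i\in\{1,\dots,N\},$$ where $f:\mathcal D\to\mathbb R$ and $\Phi_i:\mathcal D\to\mathbb S^m$, $i\in\{1,\dots,N\}$, are continuous, and where the minimum is assumed to exist. Suppose that this problem has a lossless convexification, that is, there are a mapping $h:\mathcal D\to\mathbb R^n$ such that $h(\mathcal D)$ is convex, a convex function $f':\mathbb R^n\to\mathbb R$, and convex matrix functions $\Phi_i':\mathbb R^n\to\mathbb S^m$, $i\in\{1,\dots,N\}$, such that $$f(x)=f'(h(x)),\qquad \Phi_i(x)=\Phi_i'(h(x))\qquad\text{for all }x\in\mathcal D,\ i\in\{1,\dots,N\},$$ and such that, with $$\mathcal F:=\{x\in\mathcal D:\Phi_i(x)\preceq 0,\ \forall i\in\{1,\dots,N\}\},\qquad \mathcal F':=\{v\in h(\mathcal D):\Phi_i'(v)\preceq 0,\ \forall i\in\{1,\dots,N\}\},$$ the restriction $h:\mathcal F\to\mathcal F'$ is a surjection. Suppose moreover that the primal problem satisfies Slater's condition: there exists $x\in\mathbf{relint}(\mathcal D)$ such that $\Phi_i(x)\prec 0$ for all $i\in\{1,\dots,N\}$. Then strong duality holds for the primal problem, i.e. $d^*=p^*$, where $d^*$ is the optimal value of its Lagrange dual problem.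
   Context: $\mathbb S^m$ denotes the real symmetric $m\times m$ matrices and $\mathbb S^m_+$ the cone of positive semidefinite ones. $A\preceq B$ (resp. $A\prec B$) means that $B-A$ is symmetric positive semidefinite (resp. positive definite). A matrix function $\Phi':\mathbb R^n\to\mathbb S^m$ is convex if $\Phi'(\theta v+(1-\theta)w)\preceq\theta\Phi'(v)+(1-\theta)\Phi'(w)$ for all $v,w\in\mathbb R^n$ and $\theta\in[0,1]$. The relative interior of $\mathcal D$ is $\mathbf{relint}(\mathcal D):=\{x\in\mathcal D: B(x,r)\cap\mathbf{aff}(\mathcal D)\subseteq\mathcal D\text{ for some }r>0\}$, where $B(x,r)$ is the ball of radius $r$ centered at $x$ and $\mathbf{aff}(\mathcal D)$ is the affine hull of $\mathcal D$. The Lagrangian function is $L(x,\bar\Lambda):=f(x)+\sum_{i=1}^N \mathrm{Tr}(\Lambda_i\Phi_i(x))$ for $x\in\mathcal D$ and $\bar\Lambda=(\Lambda_1,\dots,\Lambda_N)$ with $\Lambda_i\in\mathbb S^m_+$. The dual function is $g(\bar\Lambda):=\inf_{x\in\mathcal D}L(x,\bar\Lambda)\in[-\infty,\infty)$. The Lagrange dual problem is $d^*:=\sup\{g(\bar\Lambda):\Lambda_i\in\mathbb S^m_+,\ i\in\{1,\dots,N\}\}$. *)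

theory Defs
  imports "HOL-Analysis.Analysis"
begin

definition sym_matrices :: "(real^'m^'m) set" where
  "sym_matrices = {A. transpose A = A}"

definition psd_matrices :: "(real^'m^'m) set" where
  "psd_matrices = {A \<in> sym_matrices. \<forall>x. 0 \<le> x \<bullet> (A *v x)}"

definition pd_matrices :: "(real^'m^'m) set" where
  "pd_matrices = {A \<in> sym_matrices. \<forall>x. x \<noteq> 0 \<longrightarrow> 0 < x \<bullet> (A *v x)}"

definition loewner_le :: "real^'m^'m \<Rightarrow> real^'m^'m \<Rightarrow> bool"  (infix "\<preceq>\<^sub>L" 50) where
  "A \<preceq>\<^sub>L B \<longleftrightarrow> B - A \<in> psd_matrices"

definition loewner_less :: "real^'m^'m \<Rightarrow> real^'m^'m \<Rightarrow> bool"  (infix "\<prec>\<^sub>L" 50) where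
  "A \<prec>\<^sub>L B \<longleftrightarrow> B - A \<in> pd_matrices"

definition convex_matrix_function :: "(real^'n \<Rightarrow> real^'m^'m) \<Rightarrow> bool" where
  "convex_matrix_function \<Phi> \<longleftrightarrow>
     range \<Phi> \<subseteq> sym_matrices \<and>
     (\<forall>v w. \<forall>\<theta>\<in>{0..1}. \<Phi> (\<theta> *\<^sub>R v + (1 - \<theta>) *\<^sub>R w) \<preceq>\<^sub>L \<theta> *\<^sub>R \<Phi> v + (1 - \<theta>) *\<^sub>R \<Phi> w)"

text \<open>
  Functions with domain \<open>D\<close> are total functions whose values outside \<open>D\<close> are never used.
  A family indexed by \<open>{1..N}\<close> is a function on \<open>nat\<close>, likewise used only on \<open>{1..N}\<close>.
\<close>

definition feasible_set ::
  "(real^'n) set \<Rightarrow> (nat \<Rightarrow> real^'n \<Rightarrow> real^'m^'m) \<Rightarrow> nat \<Rightarrow> (real^'n) set" where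
  "feasible_set D \<Phi> N = {x \<in> D. \<forall>i\<in>{1..N}. \<Phi> i x \<preceq>\<^sub>L 0}"

definition lagrangian ::
  "(real^'n \<Rightarrow> real) \<Rightarrow> (nat \<Rightarrow> real^'n \<Rightarrow> real^'m^'m) \<Rightarrow> nat \<Rightarrow> real^'n \<Rightarrow> (nat \<Rightarrow> real^'m^'m) \<Rightarrow> real" where
  "lagrangian f \<Phi> N x \<Lambda> = f x + (\<Sum>i=1..N. trace (\<Lambda> i ** \<Phi> i x))"

definition dual_function ::
  "(real^'n) set \<Rightarrow> (real^'n \<Rightarrow> real) \<Rightarrow> (nat \<Rightarrow> real^'n \<Rightarrow> real^'m^'m) \<Rightarrow> nat \<Rightarrow> (nat \<Rightarrow> real^'m^'m) \<Rightarrow> ereal" where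
  "dual_function D f \<Phi> N \<Lambda> = (INF x\<in>D. ereal (lagrangian f \<Phi> N x \<Lambda>))"

definition dual_value ::
  "(real^'n) set \<Rightarrow> (real^'n \<Rightarrow> real) \<Rightarrow> (nat \<Rightarrow> real^'n \<Rightarrow> real^'m^'m) \<Rightarrow> nat \<Rightarrow> ereal" where
  "dual_value D f \<Phi> N = (SUP \<Lambda>\<in>{\<Lambda>. \<forall>i\<in>{1..N}. \<Lambda> i \<in> psd_matrices}. dual_function D f \<Phi> N \<Lambda>)"

definition is_primal_min ::
  "(real^'n) set \<Rightarrow> (real^'n \<Rightarrow> real) \<Rightarrow> (nat \<Rightarrow> real^'n \<Rightarrow> real^'m^'m) \<Rightarrow> nat \<Rightarrow> real \<Rightarrow> bool" where
  "is_primal_min D f \<Phi> N p \<longleftrightarrow>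
     p \<in> f ` feasible_set D \<Phi> N \<and> (\<forall>x\<in>feasible_set D \<Phi> N. p \<le> f x)"

definition lossless_convexification ::
  "(real^'n) set \<Rightarrow> (real^'n \<Rightarrow> real) \<Rightarrow> (nat \<Rightarrow> real^'n \<Rightarrow> real^'m^'m) \<Rightarrow> nat \<Rightarrow>
   (real^'n \<Rightarrow> real^'n) \<Rightarrow> (real^'n \<Rightarrow> real) \<Rightarrow> (nat \<Rightarrow> real^'n \<Rightarrow> real^'m^'m) \<Rightarrow> bool" where
  "lossless_convexification D f \<Phi> N h f' \<Phi>' \<longleftrightarrow>
     convex (h ` D) \<and>
     convex_on UNIV f' \<and>
     (\<forall>i\<in>{1..N}. convex_matrix_function (\<Phi>' i)) \<and>
     (\<forall>x\<in>D. f x = f' (h x)) \<and>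
     (\<forall>x\<in>D. \<forall>i\<in>{1..N}. \<Phi> i x = \<Phi>' i (h x)) \<and>
     h ` feasible_set D \<Phi> N = feasible_set (h ` D) \<Phi>' N"

definition slater_condition ::
  "(real^'n) set \<Rightarrow> (nat \<Rightarrow> real^'n \<Rightarrow> real^'m^'m) \<Rightarrow> nat \<Rightarrow> bool" where
  "slater_condition D \<Phi> N \<longleftrightarrow> (\<exists>x\<in>rel_interior D. \<forall>i\<in>{1..N}. \<Phi> i x \<prec>\<^sub>L 0)"

end

theory Submission
  imports Defs
begin

text \<open>
  The dual function can be computed on the convex problem over \<open>h ` D\<close>, whose constraints are
  dualized one at a time, by induction on the index set. For a single constraint, a hyperplane
  separates the origin from the upper image of (objective, constraint) in \<open>real \<times> real^'m^'m\<close>.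
  Its normal is a positive semidefinite matrix together with a nonnegative scalar, and the strictly
  feasible point excludes that the scalar vanishes. Adding the resulting Lagrange term to the
  objective keeps it convex, because positive semidefinite matrices have nonnegative inner products.
\<close>

subsection \<open>Positive semidefinite matrices\<close>

lemma psd_matrices_iff:
  "A \<in> psd_matrices \<longleftrightarrow> transpose A = A \<and> (\<forall>x. 0 \<le> x \<bullet> (A *v x))"
  by (simp add: psd_matrices_def sym_matrices_def)

lemma pd_imp_psd: "A \<in> pd_matrices \<Longrightarrow> A \<in> psd_matrices"
  unfolding pd_matrices_def psd_matrices_def
  by (auto intro: less_imp_le) (metis inner_zero_left less_imp_le order_refl)

lemma transpose_add: "transpose (A + B) = transpose A + transpose (B :: 'a::plus^'n^'m)"
  by (simp add: transpose_def vec_eq_iff)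

lemma transpose_diff: "transpose (A - B) = transpose A - transpose (B :: 'a::minus^'n^'m)"
  by (simp add: transpose_def vec_eq_iff)

lemma scaleR_matrix_vector: "(c *\<^sub>R A) *v x = c *\<^sub>R (A *v (x :: real^'n))"
  by (simp add: scaleR_matrix_vector_assoc)

lemma minus_matrix_vector: "(- A) *v x = - (A *v (x :: real^'n))"
  using scaleR_matrix_vector[of "-1" A x] by simp

lemma psd_add: "A \<in> psd_matrices \<Longrightarrow> B \<in> psd_matrices \<Longrightarrow> A + B \<in> psd_matrices"
  by (simp add: psd_matrices_iff transpose_add matrix_vector_mult_add_rdistrib inner_add_right)

lemma psd_scaleR: "0 \<le> c \<Longrightarrow> A \<in> psd_matrices \<Longrightarrow> c *\<^sub>R A \<in> psd_matrices"
  by (simp add: psd_matrices_iff transpose_scalar scaleR_matrix_vector)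

section \<open>Trace pairing and rank-one matrices\<close>

lemma inner_matrix_vector_sum:
  fixes A :: "real^'n^'m"
  shows "x \<bullet> (A *v y) = (\<Sum>i\<in>UNIV. \<Sum>j\<in>UNIV. x $ i * A $ i $ j * y $ j)"
  by (simp add: inner_vec_def matrix_vector_mult_def sum_distrib_left mult.assoc)

lemma inner_matrix_sum:
  fixes A B :: "real^'n^'m"
  shows "A \<bullet> B = (\<Sum>i\<in>UNIV. \<Sum>j\<in>UNIV. A $ i $ j * B $ i $ j)"
  by (simp add: inner_vec_def)

lemma trace_mult_symmetric:
  fixes A B :: "real^'n^'n"
  assumes "transpose A = A"
  shows "trace (A ** B) = A \<bullet> B"
proof -
  have "A $ i $ j = A $ j $ i" for i j
    using assms by (metis transpose_def vec_lambda_beta)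
  then have "trace (A ** B) = (\<Sum>i\<in>UNIV. \<Sum>k\<in>UNIV. A $ k $ i * B $ k $ i)"
    by (simp add: trace_def matrix_matrix_mult_def)
  also have "\<dots> = A \<bullet> B"
    unfolding inner_matrix_sum by (rule sum.swap)
  finally show ?thesis .
qed

text \<open>The rank-one matrix u u^T. Pairing a matrix with it evaluates the quadratic form at
  \<open>u\<close>, which links inner products of matrices to semidefiniteness.\<close>

definition outer :: "real^'n \<Rightarrow> real^'n^'n" where
  "outer u = (\<chi> i j. u $ i * u $ j)"

lemma inner_outer: "A \<bullet> outer u = u \<bullet> (A *v u)"
  by (simp add: inner_matrix_sum inner_matrix_vector_sum outer_def mult_ac)

lemma transpose_outer: "transpose (outer u) = outer u"
  by (simp add: transpose_def outer_def vec_eq_iff mult.commute)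

lemma quadratic_outer: "x \<bullet> (outer u *v x) = (x \<bullet> u)\<^sup>2"
proof -
  have "x \<bullet> (outer u *v x) = (\<Sum>i\<in>UNIV. \<Sum>j\<in>UNIV. (x $ i * u $ i) * (x $ j * u $ j))"
    by (simp add: inner_matrix_vector_sum outer_def mult_ac)
  then show ?thesis
    by (simp add: power2_eq_square inner_vec_def sum_product)
qed

section \<open>Self-duality of the semidefinite cone\<close>

lemma inner_matrix_symmetric:
  fixes A :: "real^'n^'n"
  assumes "transpose A = A"
  shows "x \<bullet> (A *v y) = y \<bullet> (A *v x)"
  by (metis assms dot_lmul_matrix inner_commute transpose_matrix_vector)

lemma inner_axis_matrix_axis: "axis i 1 \<bullet> (A *v axis j 1) = (A $ i $ j :: real)"
  by (simp add: inner_axis' matrix_vector_mult_basis column_def)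

lemma quadratic_line:
  fixes A :: "real^'n^'n"
  assumes "transpose A = A"
  shows "(x + t *\<^sub>R y) \<bullet> (A *v (x + t *\<^sub>R y)) =
    x \<bullet> (A *v x) + 2 * t * (x \<bullet> (A *v y)) + t\<^sup>2 * (y \<bullet> (A *v y))"
  using inner_matrix_symmetric[OF assms, of y x]
  by (simp add: matrix_vector_right_distrib matrix_vector_mult_scaleR inner_add_left
      inner_add_right power2_eq_square algebra_simps)

text \<open>With a zero diagonal, the form along \<open>axis i 1 + t *\<^sub>R axis j 1\<close> is
  linear in \<open>t\<close>, so nonnegativity for both signs of \<open>t\<close> kills the entry.
  This is the base case of the Schur complement induction.\<close>

lemma psd_zero_diagonal:
  fixes A :: "real^'n^'n"
  assumes A: "A \<in> psd_matrices" and diag: "\<And>i. A $ i $ i = 0"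
  shows "A = 0"
proof -
  have sym: "transpose A = A" using A by (simp add: psd_matrices_iff)
  have "A $ i $ j = 0" for i j
  proof -
    have q: "0 \<le> 2 * t * A $ i $ j" for t
    proof -
      have "0 \<le> (axis i 1 + t *\<^sub>R axis j 1) \<bullet> (A *v (axis i 1 + t *\<^sub>R axis j 1))"
        using A unfolding psd_matrices_iff by blast
      then show ?thesis
        by (simp add: quadratic_line[OF sym] inner_axis_matrix_axis diag)
    qed
    show ?thesis using q[of 1] q[of "-1"] by simp
  qed
  then show ?thesis by (simp add: vec_eq_iff)
qed

text \<open>Induction on the number of nonzero diagonal entries: a Schur complement splits off a
  rank-one summand of \<open>A\<close> and annihilates one diagonal entry.\<close>

lemma psd_inner_nonneg:
  fixes A P :: "real^'n^'n"
  assumes "A \<in> psd_matrices" and P: "P \<in> psd_matrices"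
  shows "0 \<le> A \<bullet> P"
  using assms(1)
proof (induction "card {i. A $ i $ i \<noteq> 0}" arbitrary: A rule: less_induct)
  case less
  show ?case
  proof (cases "\<forall>i. A $ i $ i = 0")
    case True
    then show ?thesis using psd_zero_diagonal[OF less.prems] by simp
  next
    case False
    then obtain k where k: "A $ k $ k \<noteq> 0" by blast
    have sym: "transpose A = A" and nn: "\<And>x. 0 \<le> x \<bullet> (A *v x)"
      using less.prems by (auto simp: psd_matrices_iff)
    define a where "a = A $ k $ k"
    have a: "a > 0"
      using nn[of "axis k 1"] k by (simp add: a_def inner_axis_matrix_axis)
    define b where "b = A *v axis k 1"
    have b: "b $ i = A $ i $ k" for i
      by (simp add: b_def matrix_vector_mult_basis column_def)
    \<comment> \<open>Scaled so that \<open>outer u\<close> is b b^T / a, which agrees with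
      \<open>A\<close> on the whole row and column \<open>k\<close>.\<close>
    define u where "u = (1 / sqrt a) *\<^sub>R b"
    define A' where "A' = A - outer u"
    have u2: "(x \<bullet> u)\<^sup>2 = (x \<bullet> b)\<^sup>2 / a" for x
      using a by (simp add: u_def power_divide)
    have "0 \<le> x \<bullet> (A' *v x)" for x
    proof -
      \<comment> \<open>The minimizer of the form of \<open>A\<close> along the line through
        \<open>x\<close> in direction \<open>axis k 1\<close>; the minimum is the form of
        \<open>A'\<close> at \<open>x\<close>.\<close>
      define t where "t = - (x \<bullet> b) / a"
      have "0 \<le> x \<bullet> (A *v x) + 2 * t * (x \<bullet> b) + t\<^sup>2 * a"
        using nn[of "x + t *\<^sub>R axis k 1"]
        by (simp add: quadratic_line[OF sym] inner_axis_matrix_axis a_def b_def)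
      also have "\<dots> = x \<bullet> (A *v x) - (x \<bullet> b)\<^sup>2 / a"
        using a by (simp add: t_def field_simps power2_eq_square)
      also have "\<dots> = x \<bullet> (A' *v x)"
        by (simp add: A'_def matrix_vector_mult_diff_rdistrib inner_diff_right quadratic_outer u2)
      finally show ?thesis .
    qed
    then have A': "A' \<in> psd_matrices"
      by (simp add: psd_matrices_iff A'_def transpose_diff transpose_outer sym)
    have diag: "A' $ i $ i = A $ i $ i - (A $ i $ k)\<^sup>2 / a" for i
      using a by (simp add: A'_def outer_def u_def b power2_eq_square)
    \<comment> \<open>Zero diagonal entries stay zero: subtracting a square makes the entry at most
      0, while semidefiniteness of \<open>A'\<close> makes it at least 0.\<close>
    have "A' $ i $ i = 0" if "A $ i $ i = 0" for i
    proof -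
      have "0 \<le> A' $ i $ i"
        using A' inner_axis_matrix_axis[of i A' i] by (metis psd_matrices_iff)
      then show ?thesis
        using diag[of i] that a by (simp add: divide_le_0_iff)
    qed
    moreover have "A' $ k $ k = 0"
      using diag[of k] a by (simp add: a_def power2_eq_square)
    ultimately have "{i. A' $ i $ i \<noteq> 0} \<subset> {i. A $ i $ i \<noteq> 0}"
      using k by blast
    then have "card {i. A' $ i $ i \<noteq> 0} < card {i. A $ i $ i \<noteq> 0}"
      by (intro psubset_card_mono) auto
    then have "0 \<le> A' \<bullet> P"
      using less.hyps A' by blast
    moreover have "0 \<le> outer u \<bullet> P"
      using P by (simp add: inner_commute[of "outer u"] inner_outer psd_matrices_iff)
    ultimately show ?thesis
      by (simp add: A'_def inner_diff_left)
  qed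
qed

text \<open>Rank-one tests give the nonnegative form, and tests without symmetry force
  \<open>M\<close> to be symmetric. It serves for the matrix part of a separating normal, about
  which no symmetry is known beforehand.\<close>

lemma psd_dual_cone:
  fixes M :: "real^'n^'n"
  assumes "\<And>P. (\<And>x. 0 \<le> x \<bullet> (P *v x)) \<Longrightarrow> 0 \<le> M \<bullet> P"
  shows "M \<in> psd_matrices"
proof -
  have tr: "y \<bullet> (y v* M) = y \<bullet> (M *v y)" for y
    using dot_lmul_matrix[of y M y] by (simp add: inner_commute)
  \<comment> \<open>\<open>P\<close> ranges over non-symmetric matrices, so a skew-symmetric choice is allowed.\<close>
  have "0 \<le> M \<bullet> (transpose M - M)"
    by (rule assms) (simp add: matrix_vector_mult_diff_rdistrib inner_diff_right tr)
  moreover have "transpose M \<bullet> transpose M = M \<bullet> M"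
    unfolding inner_matrix_sum transpose_def by (subst sum.swap) simp
  \<comment> \<open>The left side equals -2 times
    \<open>M \<bullet> (transpose M - M)\<close>.\<close>
  ultimately have "(transpose M - M) \<bullet> (transpose M - M) \<le> 0"
    by (simp add: inner_diff_left inner_diff_right inner_commute)
  then have "transpose M = M" by (simp add: inner_gt_zero_iff flip: not_less)
  moreover have "0 \<le> x \<bullet> (M *v x)" for x
    using assms[of "outer x"] by (simp add: inner_outer quadratic_outer)
  ultimately show ?thesis by (simp add: psd_matrices_iff)
qed

text \<open>The constant is the minimum of the form over the compact unit sphere, extended to all
  vectors by homogeneity.\<close>

lemma pd_bounded_below:
  fixes Q :: "real^'n^'n"
  assumes "Q \<in> pd_matrices"
  obtains c where "c > 0" "\<And>x. c * (norm x)\<^sup>2 \<le> x \<bullet> (Q *v x)"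
proof -
  have "continuous_on (sphere 0 1) (\<lambda>x. x \<bullet> (Q *v x))"
    by (intro continuous_intros linear_continuous_on matrix_vector_mul_bounded_linear)
  moreover have "sphere (0 :: real^'n) 1 \<noteq> {}" by simp
  ultimately obtain z where z: "z \<in> sphere 0 1"
      and min: "\<And>y. y \<in> sphere 0 1 \<Longrightarrow> z \<bullet> (Q *v z) \<le> y \<bullet> (Q *v y)"
    using continuous_attains_inf[OF compact_sphere, of 0 1 "\<lambda>x. x \<bullet> (Q *v x)"] by blast
  have "z \<noteq> 0" using z by auto
  then have pos: "0 < z \<bullet> (Q *v z)"
    using assms by (simp add: pd_matrices_def)
  have "(z \<bullet> (Q *v z)) * (norm x)\<^sup>2 \<le> x \<bullet> (Q *v x)" for x
  proof (cases "x = 0")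
    case False
    define y where "y = (1 / norm x) *\<^sub>R x"
    have x: "x = norm x *\<^sub>R y" using False by (simp add: y_def)
    have "z \<bullet> (Q *v z) \<le> y \<bullet> (Q *v y)"
      using False by (intro min) (simp add: y_def)
    then have "(z \<bullet> (Q *v z)) * (norm x)\<^sup>2 \<le> (y \<bullet> (Q *v y)) * (norm x)\<^sup>2"
      by (simp add: mult_right_mono)
    also have "\<dots> = x \<bullet> (Q *v x)"
      by (subst (2 3) x) (simp add: matrix_vector_mult_scaleR power2_eq_square)
    finally show ?thesis .
  qed simp
  then show thesis using that pos by blast
qed

lemma quadratic_bounded_above:
  fixes M :: "real^'n^'n"
  obtains K where "K > 0" "\<And>x. x \<bullet> (M *v x) \<le> K * (norm x)\<^sup>2"
proof -
  obtain K where K: "K > 0" "\<And>x. norm (M *v x) \<le> norm x * K"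
    using bounded_linear.pos_bounded[OF matrix_vector_mul_bounded_linear[of M]] by blast
  have "x \<bullet> (M *v x) \<le> K * (norm x)\<^sup>2" for x
  proof -
    have "x \<bullet> (M *v x) \<le> norm x * norm (M *v x)" by (rule norm_cauchy_schwarz)
    also have "\<dots> \<le> norm x * (norm x * K)" by (intro mult_left_mono K) simp
    finally show ?thesis by (simp add: power2_eq_square mult_ac)
  qed
  then show thesis using that K(1) by blast
qed

subsection \<open>Strong duality for convex constraints\<close>

lemma loewner_le_quadratic:
  "A \<preceq>\<^sub>L B \<Longrightarrow> x \<bullet> (A *v x) \<le> x \<bullet> (B *v x)"
  by (simp add: loewner_le_def psd_matrices_iff matrix_vector_mult_diff_rdistrib inner_diff_right)

lemma loewner_le_inner:
  fixes L A B :: "real^'n^'n"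
  shows "L \<in> psd_matrices \<Longrightarrow> A \<preceq>\<^sub>L B \<Longrightarrow> L \<bullet> A \<le> L \<bullet> B"
  using psd_inner_nonneg[of L "B - A"] by (simp add: loewner_le_def inner_diff_right)

lemma convex_matrix_functionD:
  assumes "convex_matrix_function \<Phi>" "0 \<le> s" "0 \<le> t" "s + t = 1"
  shows "\<Phi> (s *\<^sub>R v + t *\<^sub>R w) \<preceq>\<^sub>L s *\<^sub>R \<Phi> v + t *\<^sub>R \<Phi> w"
proof -
  have "t = 1 - s" "s \<in> {0..1}" using assms by auto
  then show ?thesis using assms(1) unfolding convex_matrix_function_def by blast
qed

text \<open>The negated value at a convex combination is the convexity gap plus the same combination
  of the negated values, a sum of semidefinite matrices.\<close>

lemma convex_sublevel_matrix:
  assumes "convex_matrix_function \<Phi>"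
  shows "convex {v. \<Phi> v \<preceq>\<^sub>L 0}"
proof (rule convexI)
  fix v w and s t :: real
  assume vw: "v \<in> {v. \<Phi> v \<preceq>\<^sub>L 0}" "w \<in> {v. \<Phi> v \<preceq>\<^sub>L 0}" and st: "0 \<le> s" "0 \<le> t" "s + t = 1"
  have "(s *\<^sub>R \<Phi> v + t *\<^sub>R \<Phi> w) - \<Phi> (s *\<^sub>R v + t *\<^sub>R w) \<in> psd_matrices"
    using convex_matrix_functionD[OF assms st] by (simp add: loewner_le_def)
  moreover have "s *\<^sub>R (- \<Phi> v) + t *\<^sub>R (- \<Phi> w) \<in> psd_matrices"
    using vw st by (intro psd_add psd_scaleR) (auto simp: loewner_le_def)
  ultimately have "- \<Phi> (s *\<^sub>R v + t *\<^sub>R w) \<in> psd_matrices"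
    using psd_add by fastforce
  then show "s *\<^sub>R v + t *\<^sub>R w \<in> {v. \<Phi> v \<preceq>\<^sub>L 0}" by (simp add: loewner_le_def)
qed

lemma convex_on_inner_matrix:
  assumes "convex_matrix_function \<Phi>" "L \<in> psd_matrices" "convex C"
  shows "convex_on C (\<lambda>v. L \<bullet> \<Phi> v)"
  unfolding convex_on_def
  using loewner_le_inner[OF assms(2) convex_matrix_functionD[OF assms(1)]] assms(3)
  by (simp add: inner_add_right)

text \<open>\<open>C\<close> is an arbitrary convex set, so that it can later absorb the other
  constraints.\<close>

lemma lagrange_multiplier_single:
  fixes C :: "(real^'n) set" and \<Phi> :: "real^'n \<Rightarrow> real^'m^'m"
  assumes F: "convex_on C F" and \<Phi>: "convex_matrix_function \<Phi>"
    and v0: "v0 \<in> C" "\<Phi> v0 \<prec>\<^sub>L 0"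
    and opt: "\<And>v. v \<in> C \<Longrightarrow> \<Phi> v \<preceq>\<^sub>L 0 \<Longrightarrow> p \<le> F v"
  shows "\<exists>L\<in>psd_matrices. \<forall>v\<in>C. p \<le> F v + L \<bullet> \<Phi> v"
proof -
  \<comment> \<open>Only quadratic forms are compared, so \<open>S\<close> need not be symmetric and
    the separation takes place in the full matrix space.\<close>
  define up where "up v S \<longleftrightarrow> (\<forall>x. x \<bullet> (\<Phi> v *v x) \<le> x \<bullet> (S *v x))" for v and S :: "real^'m^'m"
  \<comment> \<open>The strict inequality in the scalar component is what lets optimality of
    \<open>p\<close> exclude the origin.\<close>
  define A where "A = {(t, S). \<exists>v\<in>C. F v - p < t \<and> up v S}"
  have sym: "transpose (\<Phi> v) = \<Phi> v" for v
    using \<Phi> by (auto simp: convex_matrix_function_def sym_matrices_def)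
  have "convex A"
  proof (rule convexI)
    fix a b and s t :: real
    assume ab: "a \<in> A" "b \<in> A" and st: "0 \<le> s" "0 \<le> t" "s + t = 1"
    from ab obtain v w where v: "v \<in> C" "F v - p < fst a" "up v (snd a)"
      and w: "w \<in> C" "F w - p < fst b" "up w (snd b)"
      by (auto simp: A_def)
    let ?z = "s *\<^sub>R v + t *\<^sub>R w"
    have "?z \<in> C" using F v(1) w(1) st by (simp add: convex_on_def convexD)
    moreover have "F ?z - p < s * fst a + t * fst b"
    proof -
      have "F ?z \<le> s * F v + t * F w" using F v(1) w(1) st by (simp add: convex_on_def)
      also have "\<dots> = s * (F v - p) + t * (F w - p) + p"
        using st by (simp add: algebra_simps) (metis distrib_left mult.right_neutral)
      finally have "F ?z - p \<le> s * (F v - p) + t * (F w - p)" by simp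
      also have "\<dots> < s * fst a + t * fst b"
      \<comment> \<open>Strictness must come from a positive weight: \<open>s = 0\<close> forces
        \<open>t = 1\<close>.\<close>
      proof (cases "s = 0")
        case True
        then show ?thesis using st w by simp
      next
        case False
        then show ?thesis using st v w
          by (intro add_less_le_mono mult_strict_left_mono mult_left_mono) auto
      qed
      finally show ?thesis .
    qed
    moreover have "up ?z (s *\<^sub>R snd a + t *\<^sub>R snd b)"
      unfolding up_def
    proof
      fix x
      have "x \<bullet> (\<Phi> ?z *v x) \<le> x \<bullet> ((s *\<^sub>R \<Phi> v + t *\<^sub>R \<Phi> w) *v x)"
        by (intro loewner_le_quadratic convex_matrix_functionD \<Phi> st)
      also have "\<dots> = s * (x \<bullet> (\<Phi> v *v x)) + t * (x \<bullet> (\<Phi> w *v x))"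
        by (simp add: matrix_vector_mult_add_rdistrib scaleR_matrix_vector inner_add_right)
      also have "\<dots> \<le> s * (x \<bullet> (snd a *v x)) + t * (x \<bullet> (snd b *v x))"
        using v(3) w(3) st by (intro add_mono mult_left_mono) (auto simp: up_def)
      also have "\<dots> = x \<bullet> ((s *\<^sub>R snd a + t *\<^sub>R snd b) *v x)"
        by (simp add: matrix_vector_mult_add_rdistrib scaleR_matrix_vector inner_add_right)
      finally show "x \<bullet> (\<Phi> ?z *v x) \<le> x \<bullet> ((s *\<^sub>R snd a + t *\<^sub>R snd b) *v x)" .
    qed
    ultimately show "s *\<^sub>R a + t *\<^sub>R b \<in> A"
      unfolding A_def by (auto simp: case_prod_unfold)
  qed
  moreover have "0 \<notin> A"
  proof
    assume "0 \<in> A"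
    then obtain v where v: "v \<in> C" "F v < p" "up v 0" by (auto simp: A_def zero_prod_def)
    then have "- \<Phi> v \<in> psd_matrices"
      using psd_matrices_iff[of "- \<Phi> v"] sym[of v]
      by (simp add: up_def transpose_def vec_eq_iff minus_matrix_vector)
    then show False using opt[of v] v by (simp add: loewner_le_def)
  qed
  ultimately obtain n where n: "n \<noteq> 0" "\<And>z. z \<in> A \<Longrightarrow> 0 \<le> n \<bullet> z"
    using separating_hyperplane_set_0[of A] by blast
  obtain \<mu> M where nM: "n = (\<mu>, M)" by fastforce
  have sep: "0 \<le> \<mu> * t + M \<bullet> S" if "v \<in> C" "F v - p < t" "up v S" for v t S
    using n(2)[of "(t, S)"] that by (auto simp: A_def nM)
  have up_refl: "up v (\<Phi> v)" for v by (simp add: up_def)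
  have \<mu>_nonneg: "0 \<le> \<mu>"
  proof (rule ccontr)
    assume "\<not> 0 \<le> \<mu>"
    \<comment> \<open>The first argument of \<open>max\<close> puts the point in \<open>A\<close>;
      the second makes a negative \<open>\<mu>\<close> outweigh the matrix term.\<close>
    define t where "t = max (F v0 - p + 1) ((\<bar>M \<bullet> \<Phi> v0\<bar> + 1) / - \<mu>)"
    have "(\<bar>M \<bullet> \<Phi> v0\<bar> + 1) / - \<mu> \<le> t" by (simp add: t_def)
    then have "\<mu> * t \<le> - (\<bar>M \<bullet> \<Phi> v0\<bar> + 1)"
      using \<open>\<not> 0 \<le> \<mu>\<close> by (simp add: field_simps)
    moreover have "0 \<le> \<mu> * t + M \<bullet> \<Phi> v0"
      by (rule sep[OF v0(1) _ up_refl]) (simp add: t_def less_max_iff_disj)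
    ultimately show False by linarith
  qed
  have M: "M \<in> psd_matrices"
  proof (rule psd_dual_cone, rule ccontr)
    fix P :: "real^'m^'m"
    assume P: "\<And>x. 0 \<le> x \<bullet> (P *v x)" and neg: "\<not> 0 \<le> M \<bullet> P"
    \<comment> \<open>\<open>b\<close> is the separating functional at a base point of
      \<open>A\<close>; moving by \<open>r *\<^sub>R P\<close> stays in \<open>A\<close> but lowers
      the functional by more than \<open>b\<close>.\<close>
    define b where "b = \<mu> * (F v0 - p + 1) + M \<bullet> \<Phi> v0"
    define r where "r = (\<bar>b\<bar> + 1) / - (M \<bullet> P)"
    have r: "0 \<le> r" "r * (M \<bullet> P) = - (\<bar>b\<bar> + 1)"
      using neg by (auto simp: r_def field_simps)
    have "up v0 (\<Phi> v0 + r *\<^sub>R P)"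
      using P r(1) by (simp add: up_def matrix_vector_mult_add_rdistrib scaleR_matrix_vector inner_add_right)
    then have "0 \<le> b + r * (M \<bullet> P)"
      using sep[OF v0(1), of "F v0 - p + 1" "\<Phi> v0 + r *\<^sub>R P"]
      by (simp add: b_def inner_add_right add.assoc)
    then show False using r(2) by linarith
  qed
  have "\<mu> \<noteq> 0"
  proof
    assume "\<mu> = 0"
    then have "M \<noteq> 0" using n(1) by (auto simp: nM zero_prod_def)
    obtain c where c: "c > 0" "\<And>x. c * (norm x)\<^sup>2 \<le> x \<bullet> ((- \<Phi> v0) *v x)"
      using pd_bounded_below v0(2) by (auto simp: loewner_less_def)
    obtain K where K: "K > 0" "\<And>x. x \<bullet> (M *v x) \<le> K * (norm x)\<^sup>2"
      using quadratic_bounded_above by blast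
    \<comment> \<open>Slater's condition enters here: the form of \<open>\<Phi> v0\<close> is at
      most -c times the squared norm, hence at most that of this multiple of \<open>M\<close>, whose
      pairing with \<open>M\<close> is negative.\<close>
    have "up v0 ((- c / K) *\<^sub>R M)"
      unfolding up_def
    proof
      fix x
      have "(c / K) * (x \<bullet> (M *v x)) \<le> (c / K) * (K * (norm x)\<^sup>2)"
        using c(1) K by (intro mult_left_mono) auto
      also have "\<dots> \<le> x \<bullet> ((- \<Phi> v0) *v x)" using c(2)[of x] K(1) by simp
      finally show "x \<bullet> (\<Phi> v0 *v x) \<le> x \<bullet> (((- c / K) *\<^sub>R M) *v x)"
        by (simp add: scaleR_matrix_vector minus_matrix_vector)
    qed
    then have "0 \<le> (- c / K) * (M \<bullet> M)"
      using sep[OF v0(1), of "F v0 - p + 1" "(- c / K) *\<^sub>R M"] \<open>\<mu> = 0\<close> by simp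
    moreover have "0 < (c / K) * (M \<bullet> M)" using c K \<open>M \<noteq> 0\<close> by simp
    ultimately show False by simp
  qed
  then have \<mu>: "\<mu> > 0" using \<mu>_nonneg by simp
  have "p \<le> F v + ((1 / \<mu>) *\<^sub>R M) \<bullet> \<Phi> v" if v: "v \<in> C" for v
  \<comment> \<open>Points of \<open>A\<close> lie strictly above the objective, so the bound comes
    with a slack \<open>e\<close>.\<close>
  proof (rule field_le_epsilon)
    fix e :: real assume "e > 0"
    then have "0 \<le> \<mu> * (F v - p + e) + M \<bullet> \<Phi> v"
      using sep[OF v _ up_refl] by simp
    then show "p \<le> F v + ((1 / \<mu>) *\<^sub>R M) \<bullet> \<Phi> v + e"
      using \<mu> by (simp add: field_simps)
  qed
  moreover have "(1 / \<mu>) *\<^sub>R M \<in> psd_matrices" using \<mu> M by (simp add: psd_scaleR)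
  ultimately show ?thesis by blast
qed

text \<open>The objective varies in the induction: constraint \<open>j\<close> is dualized while the
  others restrict the domain, and its Lagrange term then joins the objective for the remaining
  constraints.\<close>

lemma lagrange_multipliers:
  fixes C :: "(real^'n) set" and \<Phi> :: "'i \<Rightarrow> real^'n \<Rightarrow> real^'m^'m"
  assumes "finite I" and "convex_on C F" and "\<And>i. i \<in> I \<Longrightarrow> convex_matrix_function (\<Phi> i)"
    and "v0 \<in> C" and "\<And>i. i \<in> I \<Longrightarrow> \<Phi> i v0 \<prec>\<^sub>L 0"
    and "\<And>v. v \<in> C \<Longrightarrow> \<forall>i\<in>I. \<Phi> i v \<preceq>\<^sub>L 0 \<Longrightarrow> p \<le> F v"
  shows "\<exists>L. (\<forall>i\<in>I. L i \<in> psd_matrices) \<and> (\<forall>v\<in>C. p \<le> F v + (\<Sum>i\<in>I. L i \<bullet> \<Phi> i v))"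
  using assms
proof (induction I arbitrary: F rule: finite_induct)
  case (insert j I)
  define C' where "C' = C \<inter> (\<Inter>i\<in>I. {v. \<Phi> i v \<preceq>\<^sub>L 0})"
  have C: "convex C" using insert.prems(1) by (simp add: convex_on_def)
  have "convex C'"
    unfolding C'_def using insert.prems(2)
    by (intro convex_Int convex_INT C convex_sublevel_matrix) auto
  then have "convex_on C' F"
    using insert.prems(1) by (auto simp: C'_def intro: convex_on_subset)
  moreover have "v0 \<in> C'"
    using insert.prems(3,4) by (auto simp: C'_def loewner_le_def loewner_less_def intro: pd_imp_psd)
  ultimately obtain L where L: "L \<in> psd_matrices" "\<And>v. v \<in> C' \<Longrightarrow> p \<le> F v + L \<bullet> \<Phi> j v"
    using lagrange_multiplier_single[of C' F "\<Phi> j" v0 p] insert.prems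
    by (auto simp: C'_def)
  \<comment> \<open>The bound just obtained on \<open>C'\<close> is exactly the optimality
    hypothesis of the induction for this new objective on \<open>C\<close>.\<close>
  have "convex_on C (\<lambda>v. F v + L \<bullet> \<Phi> j v)"
    using insert.prems(1,2) C L(1) by (intro convex_on_add convex_on_inner_matrix) auto
  then obtain L' where L': "\<forall>i\<in>I. L' i \<in> psd_matrices"
      "\<forall>v\<in>C. p \<le> F v + L \<bullet> \<Phi> j v + (\<Sum>i\<in>I. L' i \<bullet> \<Phi> i v)"
    using insert.IH[of "\<lambda>v. F v + L \<bullet> \<Phi> j v"] insert.prems(2-4) L(2)
    by (auto simp: C'_def)
  have "(\<Sum>i\<in>I. (L'(j := L)) i \<bullet> \<Phi> i v) = (\<Sum>i\<in>I. L' i \<bullet> \<Phi> i v)" for v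
    using insert.hyps by (intro sum.cong) auto
  then show ?case
    using L(1) L' insert.hyps by (intro exI[of _ "L'(j := L)"]) (auto simp: add.assoc)
qed auto

section \<open>Transfer to the original problem\<close>

lemma lagrangian_inner:
  assumes "\<forall>i\<in>{1..N}. \<Lambda> i \<in> psd_matrices"
  shows "lagrangian f \<Phi> N x \<Lambda> = f x + (\<Sum>i=1..N. \<Lambda> i \<bullet> \<Phi> i x)"
  using assms by (simp add: lagrangian_def trace_mult_symmetric psd_matrices_iff)

theorem theorem1:
  fixes D :: "(real^'n) set"
    and f :: "real^'n \<Rightarrow> real"
    and \<Phi> :: "nat \<Rightarrow> real^'n \<Rightarrow> real^'m^'m"
    and N :: nat
    and pstar :: real
  assumes "D \<noteq> {}"
    and "continuous_on D f"
    and "\<And>i. i \<in> {1..N} \<Longrightarrow> continuous_on D (\<Phi> i)"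
    and "\<And>i. i \<in> {1..N} \<Longrightarrow> \<Phi> i ` D \<subseteq> sym_matrices"
    and "is_primal_min D f \<Phi> N pstar"
    and "\<exists>h f' \<Phi>'. lossless_convexification D f \<Phi> N h f' \<Phi>'"
    and "slater_condition D \<Phi> N"
  shows "dual_value D f \<Phi> N = ereal pstar"
proof (rule antisym)
  obtain x where x: "x \<in> D" "\<forall>i\<in>{1..N}. \<Phi> i x \<preceq>\<^sub>L 0" "f x = pstar"
    using assms(5) by (auto simp: is_primal_min_def feasible_set_def)
  show "dual_value D f \<Phi> N \<le> ereal pstar"
    unfolding dual_value_def
  proof (rule SUP_least)
    fix \<Lambda> :: "nat \<Rightarrow> real^'m^'m"
    assume "\<Lambda> \<in> {\<Lambda>. \<forall>i\<in>{1..N}. \<Lambda> i \<in> psd_matrices}"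
    then have \<Lambda>: "\<forall>i\<in>{1..N}. \<Lambda> i \<in> psd_matrices" by simp
    \<comment> \<open>Weak duality: at the primal minimizer every Lagrange term is
      nonpositive.\<close>
    have "(\<Sum>i=1..N. \<Lambda> i \<bullet> \<Phi> i x) \<le> 0"
      using \<Lambda> x(2) by (intro sum_nonpos) (metis inner_zero_right loewner_le_inner)
    then have "lagrangian f \<Phi> N x \<Lambda> \<le> pstar"
      using x(3) by (simp add: lagrangian_inner[OF \<Lambda>])
    then show "dual_function D f \<Phi> N \<Lambda> \<le> ereal pstar"
      unfolding dual_function_def using x(1) by (intro INF_lower2[of x]) auto
  qed
next
  obtain h f' \<Phi>' where lc: "lossless_convexification D f \<Phi> N h f' \<Phi>'"
    using assms(6) by blast
  obtain x0 where "x0 \<in> rel_interior D" and x0: "\<And>i. i \<in> {1..N} \<Longrightarrow> \<Phi> i x0 \<prec>\<^sub>L 0"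
    using assms(7) by (auto simp: slater_condition_def)
  then have "x0 \<in> D" using rel_interior_subset by blast
  have "\<exists>L. (\<forall>i\<in>{1..N}. L i \<in> psd_matrices) \<and>
      (\<forall>v\<in>h ` D. pstar \<le> f' v + (\<Sum>i\<in>{1..N}. L i \<bullet> \<Phi>' i v))"
  proof (rule lagrange_multipliers[where ?v0.0 = "h x0"])
    show "convex_on (h ` D) f'"
      using lc by (auto simp: lossless_convexification_def intro: convex_on_subset)
    show "\<Phi>' i (h x0) \<prec>\<^sub>L 0" if "i \<in> {1..N}" for i
      using lc x0[OF that] \<open>x0 \<in> D\<close> that by (auto simp: lossless_convexification_def)
    show "pstar \<le> f' v" if "v \<in> h ` D" "\<forall>i\<in>{1..N}. \<Phi>' i v \<preceq>\<^sub>L 0" for v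
    proof -
      from that(1) obtain y where y: "y \<in> D" "v = h y" by blast
      \<comment> \<open>Constraint values agree along \<open>h\<close>, so a preimage of a feasible
        \<open>v\<close> is feasible and bounds the convex problem below by
        \<open>pstar\<close>.\<close>
      then have "y \<in> feasible_set D \<Phi> N"
        using that(2) lc by (auto simp: feasible_set_def lossless_convexification_def)
      then show ?thesis
        using assms(5) lc y by (auto simp: is_primal_min_def lossless_convexification_def)
    qed
  qed (use lc \<open>x0 \<in> D\<close> in \<open>auto simp: lossless_convexification_def\<close>)
  then obtain L where L: "\<forall>i\<in>{1..N}. L i \<in> psd_matrices"
      "\<And>v. v \<in> h ` D \<Longrightarrow> pstar \<le> f' v + (\<Sum>i\<in>{1..N}. L i \<bullet> \<Phi>' i v)"
    by blast
  \<comment> \<open>Evaluating the convex bound at \<open>h x\<close> turns it into a bound on the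
    original Lagrangian with the same multipliers.\<close>
  have "pstar \<le> lagrangian f \<Phi> N x L" if "x \<in> D" for x
    using L(2)[of "h x"] lc that
    by (simp add: lagrangian_inner[OF L(1)] lossless_convexification_def)
  then have "ereal pstar \<le> dual_function D f \<Phi> N L"
    unfolding dual_function_def by (intro INF_greatest) simp
  also have "\<dots> \<le> dual_value D f \<Phi> N"
    unfolding dual_value_def using L(1) by (intro SUP_upper) simp
  finally show "ereal pstar \<le> dual_value D f \<Phi> N" .
qed

end
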